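(* Consider a deterministic pushdown reward machine with stack alphabet $\Gamma$, and let $k\ge 0$ be a constant. If $|\Gamma|\ge 2$, $k$-policies incur a blowup in $O\left(|\Gamma|^k\right)$. If $|\Gamma|=1$, $k$-policies incur a blowup in $O(k)$.
   Context: A pushdown reward machine is a deterministic pushdown automaton, with finite set of states $U$ and stack alphabet $\Gamma$, which additionally outputs a real-valued reward on each transition; it is used to give rewards in a Markov decision process (MDP) with state set $S$ and action set $A$. Given a constant $k\ge 0$, a $k$-policy is a function $\pi:S\times U\times\left(\bigcup_{j\le k}\Gamma^j\right)\to\Delta(A)$, where $\Delta(A)$ is the set of probability distributions on $A$; that is, it has access to the MDP state, the machine state and only the top $k$ symbols of the stack. The size of a $k$-policy is the size of the table representing it. The blowup is the factor by which the stack information enlarges the state space on which $k$-policies are defined, hence their size; it is measured by the number of strings of length at most $k$ over $\Gamma$. *)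

theory Defs
  imports "HOL-Probability.Probability" "HOL-Library.Landau_Symbols"
begin

record ('s, 'a) mdp =
  mdp_states :: "'s set"
  actions :: "'a set"
  kernel :: "'s \<Rightarrow> 'a \<Rightarrow> 's pmf"

text \<open>Rewards are supplied by the reward machine, so the decision process carries none. State and
  action sets are finite, so that policies can be represented by tables.\<close>

definition is_mdp :: "('s, 'a) mdp \<Rightarrow> bool" where
  "is_mdp D \<longleftrightarrow>
     finite (mdp_states D) \<and> mdp_states D \<noteq> {} \<and>
     finite (actions D) \<and> actions D \<noteq> {} \<and>
     (\<forall>s\<in>mdp_states D. \<forall>a\<in>actions D. set_pmf (kernel D s a) \<subseteq> mdp_states D)"

text \<open>In \<open>delta M u x z\<close>, \<open>x = None\<close> is an \<open>\<epsilon>\<close>-move, \<open>z\<close> is the top stack symbol and the result is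
  \<open>None\<close> if no transition is enabled. A result \<open>Some (u', w, r)\<close> moves to \<open>u'\<close>, replaces
  \<open>z\<close> by the string \<open>w\<close> and outputs the reward \<open>r\<close>.\<close>

record ('u, 'i, 'g) pdrm =
  mstates :: "'u set"
  input_alphabet :: "'i set"
  stack_alphabet :: "'g set"
  delta :: "'u \<Rightarrow> 'i option \<Rightarrow> 'g \<Rightarrow> ('u \<times> 'g list \<times> real) option"
  initial_state :: 'u
  initial_stack :: 'g
  final_states :: "'u set"

definition is_dpdrm :: "('u, 'i, 'g) pdrm \<Rightarrow> bool" where
  "is_dpdrm M \<longleftrightarrow>
     finite (mstates M) \<and> finite (input_alphabet M) \<and> finite (stack_alphabet M) \<and>
     initial_state M \<in> mstates M \<and> initial_stack M \<in> stack_alphabet M \<and>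
     final_states M \<subseteq> mstates M \<and>
     (\<forall>u x z u' w r. delta M u x z = Some (u', w, r) \<longrightarrow>
        u \<in> mstates M \<and> set_option x \<subseteq> input_alphabet M \<and> z \<in> stack_alphabet M \<and>
        u' \<in> mstates M \<and> set w \<subseteq> stack_alphabet M) \<and>
     (\<forall>u z. delta M u None z \<noteq> None \<longrightarrow> (\<forall>i. delta M u (Some i) z = None))"

definition strings_upto :: "'g set \<Rightarrow> nat \<Rightarrow> 'g list set" where
  "strings_upto G k = (\<Union>j\<le>k. {w. set w \<subseteq> G \<and> length w = j})"

text \<open>The head of a list is the top of the stack: a stack \<open>v\<close> is observed as \<open>take k v\<close>, which is
  shorter than \<open>k\<close> exactly if the stack itself is.\<close>

definition policy_domain ::
    "('s, 'a) mdp \<Rightarrow> ('u, 'i, 'g) pdrm \<Rightarrow> nat \<Rightarrow> ('s \<times> 'u \<times> 'g list) set" where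
  "policy_domain D M k = mdp_states D \<times> mstates M \<times> strings_upto (stack_alphabet M) k"

definition k_policies ::
    "('s, 'a) mdp \<Rightarrow> ('u, 'i, 'g) pdrm \<Rightarrow> nat \<Rightarrow> ('s \<times> 'u \<times> 'g list \<Rightarrow> 'a pmf) set" where
  "k_policies D M k = policy_domain D M k \<rightarrow>\<^sub>E {p. set_pmf p \<subseteq> actions D}"

definition policy_table ::
    "('s, 'a) mdp \<Rightarrow> ('u, 'i, 'g) pdrm \<Rightarrow> nat \<Rightarrow> ('s \<times> 'u \<times> 'g list \<Rightarrow> 'a pmf) \<Rightarrow>
     (('s \<times> 'u \<times> 'g list) \<times> 'a \<times> real) set" where
  "policy_table D M k \<pi> = {(x, a, pmf (\<pi> x) a) | x a. x \<in> policy_domain D M k \<and> a \<in> actions D}"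

definition policy_size ::
    "('s, 'a) mdp \<Rightarrow> ('u, 'i, 'g) pdrm \<Rightarrow> nat \<Rightarrow> ('s \<times> 'u \<times> 'g list \<Rightarrow> 'a pmf) \<Rightarrow> nat" where
  "policy_size D M k \<pi> = card (policy_table D M k \<pi>)"

text \<open>Without access to the stack, policies are defined on pairs of a state of the decision process
  and a machine state.\<close>

definition blowup :: "('s, 'a) mdp \<Rightarrow> ('u, 'i, 'g) pdrm \<Rightarrow> nat \<Rightarrow> real" where
  "blowup D M k = real (card (policy_domain D M k)) / real (card (mdp_states D \<times> mstates M))"

lemma blowup_eq_card_strings:
  assumes "is_mdp D" and "is_dpdrm M"
  shows "blowup D M k = real (card (strings_upto (stack_alphabet M) k))"
proof -
  have "card (mdp_states D) \<noteq> 0" "card (mstates M) \<noteq> 0"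
    using assms by (auto simp: is_mdp_def is_dpdrm_def)
  then show ?thesis
    by (simp add: blowup_def policy_domain_def card_cartesian_product)
qed

lemma policy_size_eq_blowup:
  fixes \<pi> :: "'s \<times> 'u \<times> 'g list \<Rightarrow> 'a pmf"
  assumes "is_mdp D" and "is_dpdrm M" and "\<pi> \<in> k_policies D M k"
  shows "real (policy_size D M k \<pi>) =
    blowup D M k * real (card ((mdp_states D \<times> mstates M) \<times> actions D))"
proof -
  have "policy_table D M k \<pi> =
      (\<lambda>(x, a). (x, a, pmf (\<pi> x) a)) ` (policy_domain D M k \<times> actions D)"
    by (auto simp: policy_table_def)
  moreover have "inj_on (\<lambda>(x, a). (x, a, pmf (\<pi> x) a)) (policy_domain D M k \<times> actions D)"
    by (auto simp: inj_on_def)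
  ultimately have "policy_size D M k \<pi> = card (policy_domain D M k) * card (actions D)"
    by (simp add: policy_size_def card_image card_cartesian_product)
  moreover have "card (mdp_states D) \<noteq> 0" "card (mstates M) \<noteq> 0"
    using assms by (auto simp: is_mdp_def is_dpdrm_def)
  ultimately show ?thesis
    by (simp add: blowup_def card_cartesian_product)
qed

end

theory Submission imports Defs begin

text \<open>The blowup is exactly the number of stack strings of length at most k, that is, the
  geometric sum of the n^j for j \<le> k, where n is the size of the stack alphabet
  (\<open>blowup_eq_sum_powers\<close>). For n \<ge> 2 the last term dominates and the sum is at
  most 2 n^k (\<open>sum_powers_le_twice_power\<close>); for n = 1 it is k + 1, at most 2k once k
  \<ge> 1. The constant 2 depends on neither the process nor the machine, so both bounds are uniform
  in them.\<close>

lemma card_strings_upto: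
  assumes "finite G"
  shows "card (strings_upto G k) = (\<Sum>j\<le>k. card G ^ j)"
proof -
  have "card (strings_upto G k) = (\<Sum>j\<le>k. card {w. set w \<subseteq> G \<and> length w = j})"
    unfolding strings_upto_def
    \<comment> \<open>Classes of different lengths are disjoint, and each is finite because G
      is.\<close>
    by (rule card_UN_disjoint) (auto simp: finite_lists_length_eq[OF assms])
  then show ?thesis
    by (simp add: card_lists_length_eq[OF assms])
qed

text \<open>Since 2 \<le> n, the bound 2 n^k on the sum up to k is at most n^(k+1), the next term;
  adding that term gives 2 n^(k+1).\<close>

lemma sum_powers_le_twice_power:
  fixes n k :: nat
  assumes "n \<ge> 2"
  shows "(\<Sum>j\<le>k. n ^ j) \<le> 2 * n ^ k"
proof (induction k)
  case 0
  then show ?case by simp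
next
  case (Suc k)
  have "2 * n ^ k \<le> n * n ^ k"
    using assms by (rule mult_le_mono1)
  with Suc have "(\<Sum>j\<le>k. n ^ j) \<le> n ^ Suc k"
    unfolding power_Suc by (rule order_trans)
  then show ?case by simp
qed

lemma blowup_eq_sum_powers:
  assumes "is_mdp D" and "is_dpdrm M"
  shows "blowup D M k = real (\<Sum>j\<le>k. card (stack_alphabet M) ^ j)"
  using assms by (simp add: blowup_eq_card_strings card_strings_upto is_dpdrm_def)

theorem theorem2:
  shows "(\<lambda>(D :: ('s, 'a) mdp, M :: ('u, 'i, 'g) pdrm, k :: nat). blowup D M k)
           \<in> O[principal {(D, M, k). is_mdp D \<and> is_dpdrm M \<and> card (stack_alphabet M) \<ge> 2}](\<lambda>(D, M, k). real (card (stack_alphabet M)) ^ k)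
       \<and> (\<lambda>((D :: ('s, 'a) mdp, M :: ('u, 'i, 'g) pdrm), k :: nat). blowup D M k)
           \<in> O[principal {(D, M). is_mdp D \<and> is_dpdrm M \<and> card (stack_alphabet M) = 1} \<times>\<^sub>F at_top](\<lambda>((D, M), k). real k)"
proof
  have bound: "norm (blowup D M k) \<le> 2 * real (card (stack_alphabet M)) ^ k"
    if "is_mdp D" "is_dpdrm M" "card (stack_alphabet M) \<ge> 2"
    for D :: "('s, 'a) mdp" and M :: "('u, 'i, 'g) pdrm" and k
  proof -
    have "real (\<Sum>j\<le>k. card (stack_alphabet M) ^ j) \<le> real (2 * card (stack_alphabet M) ^ k)"
      using sum_powers_le_twice_power[OF that(3)] by (rule of_nat_mono)
    then show ?thesis
      by (simp add: blowup_eq_sum_powers[OF that(1,2)] sum_nonneg)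
  qed
  show "(\<lambda>(D :: ('s, 'a) mdp, M :: ('u, 'i, 'g) pdrm, k :: nat). blowup D M k)
      \<in> O[principal {(D, M, k). is_mdp D \<and> is_dpdrm M \<and> card (stack_alphabet M) \<ge> 2}](\<lambda>(D, M, k). real (card (stack_alphabet M)) ^ k)"
    \<comment> \<open>On a principal filter the estimate must hold at every point, k = 0 included;
      \<open>bound\<close> gives this.\<close>
    by (rule bigoI[where c = 2]) (use bound in \<open>auto simp: eventually_principal\<close>)
  have "\<forall>\<^sub>F x in principal {(D :: ('s, 'a) mdp, M :: ('u, 'i, 'g) pdrm).
        is_mdp D \<and> is_dpdrm M \<and> card (stack_alphabet M) = 1} \<times>\<^sub>F at_top.
      norm (case x of ((D, M), k) \<Rightarrow> blowup D M k) \<le> 2 * norm (case x of ((D, M), k) \<Rightarrow> real k)"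
    unfolding eventually_prod_filter
  proof (intro exI conjI)
    show "eventually (\<lambda>(D :: ('s, 'a) mdp, M :: ('u, 'i, 'g) pdrm).
        is_mdp D \<and> is_dpdrm M \<and> card (stack_alphabet M) = 1)
        (principal {(D, M). is_mdp D \<and> is_dpdrm M \<and> card (stack_alphabet M) = 1})"
      by (auto simp: eventually_principal)
    \<comment> \<open>The threshold 1 serves all pairs D, M at once. It excludes k = 0, where the
      blowup is 1 but the bound is 0; from 1 on, k + 1 \<le> 2k.\<close>
    show "eventually (\<lambda>k :: nat. k \<ge> 1) at_top"
      by (rule eventually_ge_at_top)
  qed (auto simp: blowup_eq_sum_powers)
  then show "(\<lambda>((D :: ('s, 'a) mdp, M :: ('u, 'i, 'g) pdrm), k :: nat). blowup D M k)
      \<in> O[principal {(D, M). is_mdp D \<and> is_dpdrm M \<and> card (stack_alphabet M) = 1} \<times>\<^sub>F at_top](\<lambda>((D, M), k). real k)"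
    by (intro bigoI[where c = 2]) (simp add: case_prod_unfold)
qed

end
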